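(* For every $N\ge 1$, the following identities of polynomials hold: $$p_N(s_1,\ldots,s_N)=2^{-N}\,\Phi_N(s_1,\ldots,s_N),\qquad c_N(s_1,\ldots,s_N)=(N+1)!\,2^{-N}\,\Phi_N(s_1,\ldots,s_N).$$
   Context: For $N\ge 1$ and a permutation $\pi$ of $\{1,\ldots,N+1\}$, the up-down signature of $\pi$ is $\sigma=(\sigma_1,\ldots,\sigma_N)\in\{1,-1\}^N$ with $\sigma_i=\mathrm{sign}(\pi(i+1)-\pi(i))$. For $\sigma\in\{1,-1\}^N$, $C(\sigma)$ denotes the number of permutations of $\{1,\ldots,N+1\}$ with up-down signature $\sigma$, and $P(\sigma)=C(\sigma)/(N+1)!$. Every function $\{1,-1\}^N\to\mathbb{Q}$ is given by a unique multilinear polynomial over $\mathbb{Q}$ in $s_1,\ldots,s_N$ (i.e. a linear combination of the monomials $\prod_{a\in A}s_a$, $A\subseteq\{1,\ldots,N\}$). Let $c_N(s_1,\ldots,s_N)$ and $p_N(s_1,\ldots,s_N)$ be the multilinear polynomials with $c_N(\sigma)=C(\sigma)$ and $p_N(\sigma)=P(\sigma)$ for all $\sigma\in\{1,-1\}^N$. The rational numbers $T_k$ ($k\ge1$) are defined by $\frac{\tanh z}{z}=1+\sum_{k\ge 1}T_k z^k$ (so $T_k=0$ for odd $k$, $T_2=-1/3$, $T_4=2/15$, ...). A non-empty finite set $A$ of positive integers is uniquely a union of maximal runs of consecutive integers $A=A_1\cup\cdots\cup A_k$, listed in increasing order; with $i_j=|A_j|$, the tuple $(i_1,\ldots,i_k)$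 is the run-type of $A$. For example, $\{1,2,4,5,7\}$ has run-type $(2,2,1)$. The universal polynomial is the formal infinite series in multilinear monomials $$\Phi=1+\sum_{A\neq\emptyset}T_{i_1}\cdots T_{i_k}\prod_{a\in A}s_a,$$ the sum being over all non-empty finite sets $A$ of positive integers, with $(i_1,\ldots,i_k)$ the run-type of $A$. For $N\ge1$, $\Phi_N(s_1,\ldots,s_N)=\Phi(s_1,\ldots,s_N,0,0,\ldots)$ is its truncation, i.e. the finite sum of $1$ and the terms with $A\subseteq\{1,\ldots,N\}$. *)

theory Defs
  imports
    "HOL-Library.Poly_Mapping"
    "HOL-Library.FuncSet"
    "HOL-Combinatorics.Permutations"
    "HOL-Computational_Algebra.Formal_Power_Series"
begin

section \<open>Permutations and their up-down signatures\<close>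

text \<open>Sign vectors indexed by \<open>1, \<dots>, N\<close> are extensional functions, i.e. undefined off \<open>{1..N}\<close>,
  so that there are exactly \<open>2 ^ N\<close> of them.\<close>

definition sign_vectors :: "nat \<Rightarrow> (nat \<Rightarrow> int) set" where
  "sign_vectors N = {1..N} \<rightarrow>\<^sub>E {1, -1}"

definition updown_signature :: "nat \<Rightarrow> (nat \<Rightarrow> nat) \<Rightarrow> nat \<Rightarrow> int" where
  "updown_signature N \<pi> = (\<lambda>i\<in>{1..N}. sgn (int (\<pi> (i + 1)) - int (\<pi> i)))"

definition updown_count :: "nat \<Rightarrow> (nat \<Rightarrow> int) \<Rightarrow> nat" where
  "updown_count N \<sigma> = card {\<pi>. \<pi> permutes {1..N + 1} \<and> updown_signature N \<pi> = \<sigma>}"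

definition updown_prob :: "nat \<Rightarrow> (nat \<Rightarrow> int) \<Rightarrow> rat" where
  "updown_prob N \<sigma> = of_nat (updown_count N \<sigma>) / fact (N + 1)"


section \<open>Multilinear polynomials\<close>

text \<open>Rational polynomials in the indeterminates \<open>s\<^sub>0, s\<^sub>1, s\<^sub>2, \<dots>\<close>, of which \<open>s\<^sub>0\<close> is never used:
  finitely supported maps from exponent vectors to coefficients, with the
  convolution product of \<^theory>\<open>HOL-Library.Poly_Mapping\<close>.\<close>

type_synonym mpoly = "(nat \<Rightarrow>\<^sub>0 nat) \<Rightarrow>\<^sub>0 rat"

definition mconst :: "rat \<Rightarrow> mpoly" where
  "mconst c = Poly_Mapping.single 0 c"

definition mvar :: "nat \<Rightarrow> mpoly" where
  "mvar a = Poly_Mapping.single (Poly_Mapping.single a 1) 1"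

definition mpoly_eval :: "mpoly \<Rightarrow> (nat \<Rightarrow> rat) \<Rightarrow> rat" where
  "mpoly_eval p x =
     (\<Sum>m\<in>Poly_Mapping.keys p. Poly_Mapping.lookup p m *
        (\<Prod>i\<in>Poly_Mapping.keys m. x i ^ Poly_Mapping.lookup m i))"

definition multilinear_comb :: "nat \<Rightarrow> (nat set \<Rightarrow> rat) \<Rightarrow> mpoly" where
  "multilinear_comb N c = (\<Sum>A\<in>Pow {1..N}. mconst (c A) * (\<Prod>a\<in>A. mvar a))"

definition multilinear :: "nat \<Rightarrow> mpoly \<Rightarrow> bool" where
  "multilinear N p \<longleftrightarrow> (\<exists>c. p = multilinear_comb N c)"

definition interpolates :: "nat \<Rightarrow> ((nat \<Rightarrow> int) \<Rightarrow> rat) \<Rightarrow> mpoly \<Rightarrow> bool" where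
  "interpolates N f p \<longleftrightarrow>
     multilinear N p \<and> (\<forall>\<sigma>\<in>sign_vectors N. mpoly_eval p (\<lambda>i. of_int (\<sigma> i)) = f \<sigma>)"

text \<open>The definite description is justified by the lemma \<open>interpolates_ex1\<close> below.\<close>

definition multilinear_interpolant :: "nat \<Rightarrow> ((nat \<Rightarrow> int) \<Rightarrow> rat) \<Rightarrow> mpoly" where
  "multilinear_interpolant N f = (THE p. interpolates N f p)"

definition c_poly :: "nat \<Rightarrow> mpoly" where
  "c_poly N = multilinear_interpolant N (\<lambda>\<sigma>. of_nat (updown_count N \<sigma>))"

definition p_poly :: "nat \<Rightarrow> mpoly" where
  "p_poly N = multilinear_interpolant N (updown_prob N)"


section \<open>The universal polynomial\<close>

definition fps_tanh :: "rat fps" where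
  "fps_tanh = (fps_exp 1 - fps_exp (-1)) / (fps_exp 1 + fps_exp (-1))"

definition tanh_coeff :: "nat \<Rightarrow> rat" where
  "tanh_coeff k = fps_nth (fps_tanh / fps_X) k"

definition is_run :: "nat set \<Rightarrow> nat set \<Rightarrow> bool" where
  "is_run A R \<longleftrightarrow> R \<noteq> {} \<and> R \<subseteq> A \<and> (\<exists>a b. R = {a..b})"

definition maximal_runs :: "nat set \<Rightarrow> nat set set" where
  "maximal_runs A = {R. is_run A R \<and> (\<forall>R'. is_run A R' \<and> R \<subseteq> R' \<longrightarrow> R' = R)}"

text \<open>Distinct maximal runs are disjoint, so sorting them by their minima lists them in increasing order.\<close>

definition run_type :: "nat set \<Rightarrow> nat list" where
  "run_type A = map card (sorted_key_list_of_set Min (maximal_runs A))"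

text \<open>A formal series in multilinear monomials is represented by its family of coefficients,
  indexed by the finite sets \<open>A\<close> of positive integers. The empty set has run-type \<open>[]\<close>, hence
  coefficient 1.\<close>

definition universal_series :: "nat set \<Rightarrow> rat" where
  "universal_series A = prod_list (map tanh_coeff (run_type A))"

text \<open>Putting \<open>s\<^sub>a = 0\<close> for all \<open>a > N\<close> leaves exactly the terms with \<open>A \<subseteq> {1..N}\<close>.\<close>

definition universal_poly :: "nat \<Rightarrow> mpoly" where
  "universal_poly N = multilinear_comb N universal_series"


section \<open>Existence and uniqueness of multilinear interpolants\<close>

lemma prod_mvar:
  assumes "finite A"
  shows "(\<Prod>a\<in>A. mvar a) = Poly_Mapping.single (\<Sum>a\<in>A. Poly_Mapping.single a 1) 1"
  using assms
proof (induction A rule: finite_induct)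
  case empty
  show ?case by simp
next
  case (insert a A)
  then show ?case by (simp add: mvar_def mult_single)
qed

lemma lookup_sum_single:
  assumes "finite A"
  shows "Poly_Mapping.lookup (\<Sum>a\<in>A. Poly_Mapping.single a (1::nat)) i = (if i \<in> A then 1 else 0)"
  using assms
  by (induction A rule: finite_induct) (auto simp: lookup_add lookup_single when_def)

lemma keys_sum_single:
  assumes "finite A"
  shows "Poly_Mapping.keys (\<Sum>a\<in>A. Poly_Mapping.single a (1::nat)) = A"
  using lookup_sum_single[OF assms] by (auto simp: in_keys_iff split: if_splits)

lemma mpoly_eval_superset:
  assumes "finite K" "Poly_Mapping.keys p \<subseteq> K"
  shows "mpoly_eval p x = (\<Sum>m\<in>K. Poly_Mapping.lookup p m *
           (\<Prod>i\<in>Poly_Mapping.keys m. x i ^ Poly_Mapping.lookup m i))"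
  unfolding mpoly_eval_def using assms
  by (intro sum.mono_neutral_left) (auto simp: in_keys_iff)

lemma mpoly_eval_0 [simp]: "mpoly_eval 0 x = 0"
  by (simp add: mpoly_eval_def)

lemma mpoly_eval_add: "mpoly_eval (p + q) x = mpoly_eval p x + mpoly_eval q x"
proof -
  define K where "K = Poly_Mapping.keys p \<union> Poly_Mapping.keys q"
  have K: "finite K" "Poly_Mapping.keys p \<subseteq> K" "Poly_Mapping.keys q \<subseteq> K"
    "Poly_Mapping.keys (p + q) \<subseteq> K"
    using keys_add[of p q] by (auto simp: K_def)
  show ?thesis
    by (simp add: mpoly_eval_superset[OF K(1)] K lookup_add distrib_right sum.distrib)
qed

lemma mpoly_eval_sum: "mpoly_eval (\<Sum>a\<in>A. f a) x = (\<Sum>a\<in>A. mpoly_eval (f a) x)"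
  by (induction A rule: infinite_finite_induct) (simp_all add: mpoly_eval_add)

lemma mpoly_eval_monomial:
  assumes "finite A"
  shows "mpoly_eval (mconst c * (\<Prod>a\<in>A. mvar a)) x = c * (\<Prod>a\<in>A. x a)"
proof -
  define m where "m = (\<Sum>a\<in>A. Poly_Mapping.single a (1::nat))"
  have "mconst c * (\<Prod>a\<in>A. mvar a) = Poly_Mapping.single m c"
    by (simp add: prod_mvar[OF assms] mconst_def mult_single m_def)
  moreover have "mpoly_eval (Poly_Mapping.single m c) x =
      c * (\<Prod>i\<in>Poly_Mapping.keys m. x i ^ Poly_Mapping.lookup m i)"
    by (simp add: mpoly_eval_superset[of "{m}"])
  moreover have "(\<Prod>i\<in>Poly_Mapping.keys m. x i ^ Poly_Mapping.lookup m i) = (\<Prod>a\<in>A. x a)"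
    unfolding m_def keys_sum_single[OF assms]
    by (intro prod.cong) (simp_all add: lookup_sum_single[OF assms] del: One_nat_def)
  ultimately show ?thesis by simp
qed

lemma mpoly_eval_multilinear_comb:
  "mpoly_eval (multilinear_comb N c) x = (\<Sum>A\<in>Pow {1..N}. c A * (\<Prod>a\<in>A. x a))"
  unfolding multilinear_comb_def mpoly_eval_sum
  by (intro sum.cong refl mpoly_eval_monomial) (auto intro: finite_subset)

lemma sum_Pow_insert:
  fixes g :: "'a set \<Rightarrow> 'b::comm_monoid_add"
  assumes "finite S" "n \<notin> S"
  shows "(\<Sum>A\<in>Pow (insert n S). g A) = (\<Sum>A\<in>Pow S. g A + g (insert n A))"
proof -
  have "inj_on (insert n) (Pow S)"
    using assms(2) by (auto simp: inj_on_def insert_ident)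
  moreover have "Pow S \<inter> insert n ` Pow S = {}"
    using assms(2) by auto
  ultimately show ?thesis
    using assms(1) by (simp add: Pow_insert sum.union_disjoint sum.reindex sum.distrib)
qed

lemma sign_sum_insert:
  fixes c :: "'a set \<Rightarrow> rat"
  assumes "finite S" "n \<notin> S"
  shows "(\<Sum>A\<in>Pow (insert n S). c A * (\<Prod>a\<in>A. of_int ((\<sigma>(n := e)) a))) =
         (\<Sum>A\<in>Pow S. (c A + of_int e * c (insert n A)) * (\<Prod>a\<in>A. of_int (\<sigma> a)))"
  unfolding sum_Pow_insert[OF assms]
proof (intro sum.cong refl)
  fix A assume "A \<in> Pow S"
  then have A: "finite A" "n \<notin> A"
    using assms finite_subset by auto
  have "(\<Prod>a\<in>A. of_int ((\<sigma>(n := e)) a)) = (\<Prod>a\<in>A. of_int (\<sigma> a) :: rat)"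
    using A by (intro prod.cong) auto
  then show "c A * (\<Prod>a\<in>A. of_int ((\<sigma>(n := e)) a)) +
      c (insert n A) * (\<Prod>a\<in>insert n A. of_int ((\<sigma>(n := e)) a)) =
      (c A + of_int e * c (insert n A)) * (\<Prod>a\<in>A. of_int (\<sigma> a))"
    using A by (simp add: algebra_simps del: fun_upd_apply) (simp add: algebra_simps)
qed

lemma sign_functions_expand:
  fixes f :: "('a \<Rightarrow> int) \<Rightarrow> rat"
  assumes "finite S"
  shows "\<exists>c. \<forall>\<sigma>\<in>S \<rightarrow>\<^sub>E {1, -1}. (\<Sum>A\<in>Pow S. c A * (\<Prod>a\<in>A. of_int (\<sigma> a))) = f \<sigma>"
  using assms
proof (induction S arbitrary: f rule: finite_induct)
  case empty
  show ?case
    by (intro exI[of _ "\<lambda>_. f (\<lambda>_. undefined)"]) simp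
next
  case (insert n S)
  obtain g where g: "\<forall>\<sigma>\<in>S \<rightarrow>\<^sub>E {1, -1}.
      (\<Sum>A\<in>Pow S. g A * (\<Prod>a\<in>A. of_int (\<sigma> a))) = f (\<sigma>(n := 1))"
    using insert.IH[of "\<lambda>\<sigma>. f (\<sigma>(n := 1))"] by blast
  obtain h where h: "\<forall>\<sigma>\<in>S \<rightarrow>\<^sub>E {1, -1}.
      (\<Sum>A\<in>Pow S. h A * (\<Prod>a\<in>A. of_int (\<sigma> a))) = f (\<sigma>(n := -1))"
    using insert.IH[of "\<lambda>\<sigma>. f (\<sigma>(n := -1))"] by blast
  define c where "c A = (if n \<in> A then (g (A - {n}) - h (A - {n})) / 2 else (g A + h A) / 2)" for A
  have c: "c A + c (insert n A) = g A" "c A - c (insert n A) = h A" if "A \<subseteq> S" for A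
  proof -
    have "n \<notin> A" using that insert.hyps(2) by blast
    then show "c A + c (insert n A) = g A" "c A - c (insert n A) = h A"
      by (simp_all add: c_def field_simps)
  qed
  show ?case
  proof (intro exI[of _ c] ballI)
    fix \<sigma> :: "'a \<Rightarrow> int" assume "\<sigma> \<in> insert n S \<rightarrow>\<^sub>E {1, -1}"
    then obtain e \<tau> where e: "e = 1 \<or> e = -1" and \<tau>: "\<tau> \<in> S \<rightarrow>\<^sub>E {1, -1}" and \<sigma>: "\<sigma> = \<tau>(n := e)"
      unfolding PiE_insert_eq by auto
    have "(\<Sum>A\<in>Pow (insert n S). c A * (\<Prod>a\<in>A. of_int (\<sigma> a))) =
        (\<Sum>A\<in>Pow S. (c A + of_int e * c (insert n A)) * (\<Prod>a\<in>A. of_int (\<tau> a)))"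
      unfolding \<sigma> by (rule sign_sum_insert[OF insert.hyps])
    also have "\<dots> = (\<Sum>A\<in>Pow S. (if e = 1 then g A else h A) * (\<Prod>a\<in>A. of_int (\<tau> a)))"
      using e c by (intro sum.cong) auto
    also have "\<dots> = f \<sigma>"
      using e g \<tau> h by (auto simp: \<sigma>)
    finally show "(\<Sum>A\<in>Pow (insert n S). c A * (\<Prod>a\<in>A. of_int (\<sigma> a))) = f \<sigma>" .
  qed
qed

lemma sign_functions_unique:
  fixes c d :: "'a set \<Rightarrow> rat"
  assumes "finite S"
    and "\<And>\<sigma>. \<sigma> \<in> S \<rightarrow>\<^sub>E {1, -1} \<Longrightarrow>
      (\<Sum>A\<in>Pow S. c A * (\<Prod>a\<in>A. of_int (\<sigma> a))) = (\<Sum>A\<in>Pow S. d A * (\<Prod>a\<in>A. of_int (\<sigma> a)))"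
    and "A \<subseteq> S"
  shows "c A = d A"
  using assms
proof (induction S arbitrary: c d A rule: finite_induct)
  case empty
  then show ?case by simp
next
  case (insert n S)
  have *: "c B + of_int e * c (insert n B) = d B + of_int e * d (insert n B)"
    if e: "e = 1 \<or> e = -1" and B: "B \<subseteq> S" for e :: int and B
  proof (rule insert.IH[where c = "\<lambda>B. c B + of_int e * c (insert n B)"
        and d = "\<lambda>B. d B + of_int e * d (insert n B)", OF _ B])
    fix \<sigma> :: "'a \<Rightarrow> int" assume "\<sigma> \<in> S \<rightarrow>\<^sub>E {1, -1}"
    then have "\<sigma>(n := e) \<in> insert n S \<rightarrow>\<^sub>E {1, -1}"
      using e by (intro PiE_fun_upd) auto
    from insert.prems(1)[OF this]
    show "(\<Sum>A\<in>Pow S. (c A + of_int e * c (insert n A)) * (\<Prod>a\<in>A. of_int (\<sigma> a))) =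
        (\<Sum>A\<in>Pow S. (d A + of_int e * d (insert n A)) * (\<Prod>a\<in>A. of_int (\<sigma> a)))"
      by (simp only: sign_sum_insert[OF insert.hyps])
  qed
  have eq: "c B = d B \<and> c (insert n B) = d (insert n B)" if "B \<subseteq> S" for B
    using *[of 1 B] *[of "-1" B] that by simp
  show ?case
  proof (cases "n \<in> A")
    case True
    then have "insert n (A - {n}) = A" "A - {n} \<subseteq> S"
      using insert.prems(2) by auto
    then show ?thesis using eq[of "A - {n}"] by simp
  next
    case False
    then show ?thesis using eq[of A] insert.prems(2) by blast
  qed
qed

lemma interpolates_ex1: "\<exists>!p. interpolates N f p"
proof -
  obtain c where c: "\<forall>\<sigma>\<in>{1..N} \<rightarrow>\<^sub>E {1, -1}.
      (\<Sum>A\<in>Pow {1..N}. c A * (\<Prod>a\<in>A. of_int (\<sigma> a))) = f \<sigma>"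
    using sign_functions_expand[of "{1..N}" f] by auto
  show ?thesis
  proof (rule ex1I)
    show "interpolates N f (multilinear_comb N c)"
      using c by (auto simp: interpolates_def multilinear_def sign_vectors_def
          mpoly_eval_multilinear_comb)
  next
    fix p assume p: "interpolates N f p"
    then obtain d where d: "p = multilinear_comb N d"
      by (auto simp: interpolates_def multilinear_def)
    have "d A = c A" if "A \<subseteq> {1..N}" for A
    proof (rule sign_functions_unique[OF _ _ that])
      fix \<sigma> :: "nat \<Rightarrow> int" assume \<sigma>: "\<sigma> \<in> {1..N} \<rightarrow>\<^sub>E {1, -1}"
      then have "(\<Sum>A\<in>Pow {1..N}. d A * (\<Prod>a\<in>A. of_int (\<sigma> a))) = f \<sigma>"
        using p unfolding d interpolates_def sign_vectors_def mpoly_eval_multilinear_comb by blast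
      then show "(\<Sum>A\<in>Pow {1..N}. d A * (\<Prod>a\<in>A. of_int (\<sigma> a))) =
          (\<Sum>A\<in>Pow {1..N}. c A * (\<Prod>a\<in>A. of_int (\<sigma> a)))"
        using c \<sigma> by simp
    qed simp
    then show "p = multilinear_comb N c"
      unfolding d multilinear_comb_def by (intro sum.cong) auto
  qed
qed

lemma interpolates_multilinear_interpolant: "interpolates N f (multilinear_interpolant N f)"
  unfolding multilinear_interpolant_def by (rule theI'[OF interpolates_ex1])

end

theory Submission
  imports Defs "HOL-Combinatorics.Multiset_Permutations"
begin

text \<open>
  Consider the mean of \<open>\<Prod>a\<in>{1..N}. 1 + \<sigma>\<^sub>a(\<pi>) s\<^sub>a\<close> over all permutations \<open>\<pi>\<close>, where \<open>\<sigma>(\<pi>)\<close> is the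
  signature of \<open>\<pi>\<close>. At a sign vector \<open>s\<close> the product is \<open>2 ^ N\<close> if \<open>\<sigma>(\<pi>) = s\<close> and \<open>0\<close> otherwise, so
  this mean is \<open>2 ^ N P(s)\<close>. Expanding the product, the coefficient of \<open>\<Prod>a\<in>A. s\<^sub>a\<close> is the mean of
  \<open>\<Prod>a\<in>A. \<sigma>\<^sub>a(\<pi>)\<close>. Multilinear interpolants are unique, so it remains to show that this last mean is
  the product of the numbers \<open>T\<^sub>i\<close> over the lengths \<open>i\<close> of the maximal runs of \<open>A\<close>.

  Two facts give this. First, the relative orders of the entries in two complementary blocks of
  consecutive positions are independent. Distinct maximal runs of \<open>A\<close> involve disjoint blocks of
  positions, so the mean factors over the runs (\<open>has_mean_split\<close>, \<open>has_mean_signs_on\<close>).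

  Second, let \<open>t\<^sub>n\<close> be the mean of the product of all \<open>n - 1\<close> signs of an arrangement of \<open>n\<close> numbers.
  Write each sign as \<open>2 [ascent] - 1\<close>, expanding from right to left until the first term \<open>-1\<close> is
  chosen. A block of \<open>b\<close> entries with the factor \<open>2 [ascent]\<close> at each of its gaps has mean
  \<open>y\<^sub>b = 2 ^ (b - 1) / b!\<close>, and a term \<open>-1\<close> separates two independent parts; hence
  \<open>t\<^sub>n = y\<^sub>n - (\<Sum>r=1..n-1. t\<^sub>r y\<^bsub>n-r\<^esub>)\<close>. For the generating functions \<open>t\<close> and \<open>y = (exp (2z) - 1) / 2\<close>
  this says \<open>t (1 + y) = y\<close>, so \<open>t = tanh z\<close> and \<open>t\<^sub>n = T\<^bsub>n-1\<^esub>\<close> (\<open>fps_tanh_recurrence\<close>, \<open>has_mean_signs\<close>).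
\<close>


section \<open>Maximal runs\<close>

text \<open>The position \<open>m\<close> belongs to neither part, so no run can meet both.\<close>

lemma is_run_separated_union:
  assumes "A \<subseteq> {..<m}"
  shows "is_run (A \<union> {m+1..m+k}) R \<longleftrightarrow> is_run A R \<or> is_run {m+1..m+k} R"
proof
  assume "is_run (A \<union> {m+1..m+k}) R"
  then obtain a b where R: "R = {a..b}" "a \<le> b" and sub: "{a..b} \<subseteq> A \<union> {m+1..m+k}"
    by (auto simp: is_run_def)
  have "m \<notin> A \<union> {m+1..m+k}" using assms by auto
  with sub have "b < m \<or> m < a" by (meson atLeastAtMost_iff not_le subsetD)
  then show "is_run A R \<or> is_run {m+1..m+k} R"
  proof
    assume "b < m"
    then have "{a..b} \<subseteq> A" using sub by fastforce
    then show ?thesis using R by (auto simp: is_run_def)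
  next
    assume "m < a"
    then have "{a..b} \<subseteq> {m+1..m+k}" using sub assms by fastforce
    then show ?thesis using R by (auto simp: is_run_def)
  qed
qed (auto simp: is_run_def)

lemma maximal_runs_separated_union:
  assumes A: "A \<subseteq> {..<m}" and k: "k \<ge> 1"
  shows "maximal_runs (A \<union> {m+1..m+k}) = insert {m+1..m+k} (maximal_runs A)"
proof -
  define J where "J = {m+1..m+k}"
  have disj: "A \<inter> J = {}" using A by (auto simp: J_def)
  have "m + 1 \<in> J" using k by (simp add: J_def)
  then have J: "is_run J J" unfolding is_run_def J_def by blast
  have ne: "R \<noteq> {}" "R \<subseteq> B" if "is_run B R" for B R
    using that by (simp_all add: is_run_def)
  have apart: "\<not> R \<subseteq> R'" "\<not> R' \<subseteq> R" if "is_run A R" "is_run J R'" for R R'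
    using ne[OF that(1)] ne[OF that(2)] disj by blast+
  have union: "is_run (A \<union> J) R \<longleftrightarrow> is_run A R \<or> is_run J R" for R
    unfolding J_def by (rule is_run_separated_union[OF A])
  have "R \<in> maximal_runs (A \<union> J) \<longleftrightarrow> R = J \<or> R \<in> maximal_runs A" for R
  proof (cases "is_run J R")
    case True
    then have "R \<in> maximal_runs (A \<union> J) \<longleftrightarrow> (\<forall>R'. is_run J R' \<and> R \<subseteq> R' \<longrightarrow> R' = R)"
      using apart[OF _ True] by (simp add: maximal_runs_def union) metis
    also have "\<dots> \<longleftrightarrow> R = J"
      using J ne(2)[OF True] ne(2)[of J] by (metis subset_antisym)
    also have "\<dots> \<longleftrightarrow> R = J \<or> R \<in> maximal_runs A"
      using apart(1)[OF _ True, of R] by (simp add: maximal_runs_def) metis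
    finally show ?thesis .
  next
    case False
    then have "R \<noteq> J" using J by metis
    moreover have "\<not> R \<subseteq> R'" if "is_run A R" "is_run J R'" for R'
      using apart[OF that] by simp
    ultimately show ?thesis
      using False by (simp add: maximal_runs_def union) metis
  qed
  then have "maximal_runs (A \<union> J) = insert J (maximal_runs A)" by (simp add: set_eq_iff)
  then show ?thesis unfolding J_def .
qed

lemma maximal_runs_subset: "R \<in> maximal_runs A \<Longrightarrow> R \<subseteq> A"
  unfolding maximal_runs_def is_run_def by blast

lemma finite_maximal_runs: "finite A \<Longrightarrow> finite (maximal_runs A)"
  by (rule finite_subset[of _ "Pow A"]) (auto dest: maximal_runs_subset)

lemma inj_on_Min_maximal_runs: "inj_on Min (maximal_runs A)"
proof (rule inj_onI)
  fix R R' assume R: "R \<in> maximal_runs A" and R': "R' \<in> maximal_runs A" and eq: "Min R = Min R'"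
  from R obtain a b where ab: "R = {a..b}" "a \<le> b" by (auto simp: maximal_runs_def is_run_def)
  from R' obtain c d where cd: "R' = {c..d}" "c \<le> d" by (auto simp: maximal_runs_def is_run_def)
  have "Min {a..b} = a" "Min {c..d} = c" using ab cd by (auto intro: Min_eqI)
  then have "a = c" using eq ab cd by simp
  then have "R \<subseteq> R' \<or> R' \<subseteq> R" using ab cd by auto
  then show "R = R'" using R R' unfolding maximal_runs_def by blast
qed

lemma (in linorder) set_distinct_sorted_key_list_of_set:
  assumes "inj_on f A" "finite A"
  shows "set (sorted_key_list_of_set f A) = A \<and> distinct (sorted_key_list_of_set f A)"
proof -
  interpret folding_insort_key less_eq less A f
    by unfold_locales (rule assms)
  show ?thesis
    using distinct_sorted_key_list_of_set[of A] distinct_if_distinct_map assms by auto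
qed

lemma universal_series_eq_prod:
  assumes "finite A"
  shows "universal_series A = (\<Prod>R\<in>maximal_runs A. tanh_coeff (card R))"
proof -
  let ?xs = "sorted_key_list_of_set Min (maximal_runs A)"
  have "set ?xs = maximal_runs A" "distinct ?xs"
    using set_distinct_sorted_key_list_of_set
      [OF inj_on_Min_maximal_runs finite_maximal_runs[OF assms]]
    by auto
  with prod.distinct_set_conv_list[of ?xs "\<lambda>R. tanh_coeff (card R)"] show ?thesis
    by (simp add: universal_series_def run_type_def comp_def)
qed

lemma universal_series_empty: "universal_series {} = 1"
proof -
  have "maximal_runs {} = {}"
    unfolding maximal_runs_def is_run_def by blast
  then show ?thesis by (simp add: universal_series_eq_prod)
qed

lemma universal_series_separated_union:
  assumes A: "A \<subseteq> {..<m}" and k: "k \<ge> 1"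
  shows "universal_series (A \<union> {m+1..m+k}) = universal_series A * tanh_coeff k"
proof -
  have fin: "finite A" using A finite_subset by blast
  have "{m+1..m+k} \<notin> maximal_runs A"
  proof
    assume "{m+1..m+k} \<in> maximal_runs A"
    then have "{m+1..m+k} \<subseteq> {..<m}" using A maximal_runs_subset by blast
    then have "m + 1 \<in> {..<m}" using k by (meson atLeastAtMost_iff add_left_mono order_refl subsetD)
    then show False by simp
  qed
  then show ?thesis
    using fin by (simp add: universal_series_eq_prod maximal_runs_separated_union[OF A k]
        finite_maximal_runs mult.commute del: One_nat_def)
qed


section \<open>Means of local weights over arrangements\<close>

text \<open>An arrangement of a set is a list of its elements without repetition. The factor at the gap \<open>a\<close>,
  counted from 1, is chosen by \<open>w a\<close> according to whether the \<open>a\<close>-th and \<open>(a+1)\<close>-st entries form an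
  ascent; as lists are indexed from 0, these are the entries \<open>a - 1\<close> and \<open>a\<close>.\<close>

definition pattern_weight :: "(nat \<Rightarrow> bool \<Rightarrow> rat) \<Rightarrow> nat list \<Rightarrow> rat" where
  "pattern_weight w xs = (\<Prod>a\<in>{1..<length xs}. w a (xs ! (a - 1) < xs ! a))"

text \<open>The weight \<open>w\<close> has mean \<open>\<mu>\<close> over the arrangements of any set of \<open>n\<close> numbers. Requiring this of all
  such sets, rather than of \<open>{1..n}\<close>, lets the parts of a split arrangement be treated without
  relabelling their entries.\<close>

definition has_mean :: "(nat \<Rightarrow> bool \<Rightarrow> rat) \<Rightarrow> nat \<Rightarrow> rat \<Rightarrow> bool" where
  "has_mean w n \<mu> \<longleftrightarrow> (\<forall>V. finite V \<and> card V = n \<longrightarrow>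
     (\<Sum>xs\<in>permutations_of_set V. pattern_weight w xs) = fact n * \<mu>)"

lemma pattern_weight_cong:
  assumes "\<And>a. a \<in> {1..<length xs} \<Longrightarrow> w a = w' a"
  shows "pattern_weight w xs = pattern_weight w' xs"
  using assms unfolding pattern_weight_def by (intro prod.cong) auto

lemma has_mean_cong:
  assumes "\<And>a. a \<in> {1..<n} \<Longrightarrow> w a = w' a"
  shows "has_mean w n \<mu> \<longleftrightarrow> has_mean w' n \<mu>"
proof -
  have "pattern_weight w xs = pattern_weight w' xs"
    if "xs \<in> permutations_of_set V" "card V = n" for xs V
    using that assms by (intro pattern_weight_cong) (simp add: length_finite_permutations_of_set)
  then have "(\<Sum>xs\<in>permutations_of_set V. pattern_weight w xs) =
      (\<Sum>xs\<in>permutations_of_set V. pattern_weight w' xs)" if "card V = n" for V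
    using that by (intro sum.cong) auto
  then show ?thesis unfolding has_mean_def by auto
qed

lemma pattern_weight_append:
  assumes "w (length ys) = (\<lambda>_. 1)"
  shows "pattern_weight w (ys @ zs) =
    pattern_weight w ys * pattern_weight (\<lambda>a. w (length ys + a)) zs"
proof (cases "ys = [] \<or> zs = []")
  case True
  then show ?thesis by (auto simp: pattern_weight_def)
next
  case False
  define m where "m = length ys"
  define k where "k = length zs"
  have mk: "m \<ge> 1" "k \<ge> 1" using False by (auto simp: m_def k_def Suc_le_eq)
  let ?f = "\<lambda>a. w a ((ys @ zs) ! (a - 1) < (ys @ zs) ! a)"
  have split: "{1..<m+k} = insert m ({1..<m} \<union> (+) m ` {1..<k})"
    using mk by auto
  have "pattern_weight w (ys @ zs) = prod ?f {1..<m+k}"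
    by (simp add: pattern_weight_def m_def k_def)
  also have "\<dots> = prod ?f ({1..<m} \<union> (+) m ` {1..<k})"
    using assms unfolding split by (subst prod.insert) (auto simp: m_def)
  also have "\<dots> = prod ?f {1..<m} * prod ?f ((+) m ` {1..<k})"
    by (intro prod.union_disjoint) auto
  also have "prod ?f {1..<m} = pattern_weight w ys"
    unfolding pattern_weight_def m_def by (intro prod.cong) (auto simp: nth_append)
  also have "prod ?f ((+) m ` {1..<k}) = pattern_weight (\<lambda>a. w (m + a)) zs"
    unfolding pattern_weight_def
    by (subst prod.reindex, simp, intro prod.cong) (auto simp: nth_append m_def k_def)
  finally show ?thesis by (simp add: m_def)
qed

text \<open>An arrangement is cut after its first \<open>m\<close> entries; \<open>W\<close> is the set of those entries.\<close>

lemma sum_permutations_of_set_split: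
  fixes f :: "'a list \<Rightarrow> 'b::comm_monoid_add"
  assumes V: "finite V" "card V = m + k"
  shows "(\<Sum>xs\<in>permutations_of_set V. f xs) =
    (\<Sum>W\<in>{W. W \<subseteq> V \<and> card W = m}.
       \<Sum>ys\<in>permutations_of_set W. \<Sum>zs\<in>permutations_of_set (V - W). f (ys @ zs))"
proof -
  let ?I = "{W. W \<subseteq> V \<and> card W = m}"
  let ?S = "SIGMA W:?I. permutations_of_set W \<times> permutations_of_set (V - W)"
  have finI: "finite ?I" using V by simp
  have "(\<Sum>W\<in>?I. \<Sum>ys\<in>permutations_of_set W. \<Sum>zs\<in>permutations_of_set (V - W). f (ys @ zs)) =
      (\<Sum>p\<in>?S. f (fst (snd p) @ snd (snd p)))"
    using finI by (simp add: sum.cartesian_product sum.Sigma) (simp add: case_prod_unfold)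
  also have "\<dots> = (\<Sum>xs\<in>permutations_of_set V. f xs)"
  proof (rule sum.reindex_bij_witness[where i = "\<lambda>xs. (set (take m xs), take m xs, drop m xs)"
        and j = "\<lambda>p. fst (snd p) @ snd (snd p)"])
    fix p assume "p \<in> ?S"
    then obtain W ys zs where p: "p = (W, ys, zs)" "W \<subseteq> V" "card W = m"
      "ys \<in> permutations_of_set W" "zs \<in> permutations_of_set (V - W)" by auto
    then have "length ys = m" by (auto simp: permutations_of_set_def distinct_card)
    then show "(set (take m (fst (snd p) @ snd (snd p))), take m (fst (snd p) @ snd (snd p)),
      drop m (fst (snd p) @ snd (snd p))) = p"
      using p by (auto simp: permutations_of_set_def)
    show "fst (snd p) @ snd (snd p) \<in> permutations_of_set V"
      using p by (auto simp: permutations_of_set_def)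
  next
    fix xs assume "xs \<in> permutations_of_set V"
    then have xs: "set xs = V" "distinct xs" by (auto simp: permutations_of_set_def)
    then have "length xs = m + k" using V distinct_card by fastforce
    then have card: "card (set (take m xs)) = m" using xs by (simp add: distinct_card)
    have sub: "set (take m xs) \<subseteq> V" using xs set_take_subset by metis
    have un: "set (take m xs) \<union> set (drop m xs) = V" using xs by (metis append_take_drop_id set_append)
    have "set (take m xs) \<inter> set (drop m xs) = {}" using xs
      by (metis append_take_drop_id distinct_append)
    then have "set (drop m xs) = V - set (take m xs)" using un by blast
    then show "(set (take m xs), take m xs, drop m xs) \<in> ?S"
      using card sub xs by (auto simp: permutations_of_set_def)
  qed auto
  finally show ?thesis by simp
qed

text \<open>Independence: if the gap \<open>m\<close> carries no weight, the entries before and after it contribute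
  independent factors, each of the \<open>(m + k) choose m\<close> choices of the set of the first entries
  contributing equally.\<close>

lemma has_mean_split:
  assumes p: "has_mean w m p" and q: "has_mean (\<lambda>a. w (m + a)) k q" and one: "w m = (\<lambda>_. 1)"
  shows "has_mean w (m + k) (p * q)"
  unfolding has_mean_def
proof (intro allI impI, elim conjE)
  fix V :: "nat set" assume V: "finite V" "card V = m + k"
  have "(\<Sum>ys\<in>permutations_of_set W. \<Sum>zs\<in>permutations_of_set (V - W). pattern_weight w (ys @ zs)) =
      fact m * p * (fact k * q)" if W: "W \<subseteq> V" "card W = m" for W
  proof -
    have fin: "finite W" "finite (V - W)" using W V finite_subset by auto
    have card: "card (V - W) = k" using W V fin by (simp add: card_Diff_subset)
    have "(\<Sum>ys\<in>permutations_of_set W. \<Sum>zs\<in>permutations_of_set (V - W). pattern_weight w (ys @ zs)) =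
      (\<Sum>ys\<in>permutations_of_set W. \<Sum>zs\<in>permutations_of_set (V - W).
         pattern_weight w ys * pattern_weight (\<lambda>a. w (m + a)) zs)"
      using one W by (intro sum.cong refl) (simp add: pattern_weight_append length_finite_permutations_of_set)
    also have "\<dots> = (\<Sum>ys\<in>permutations_of_set W. pattern_weight w ys) *
        (\<Sum>zs\<in>permutations_of_set (V - W). pattern_weight (\<lambda>a. w (m + a)) zs)"
      by (simp add: sum_product)
    also have "\<dots> = fact m * p * (fact k * q)"
      using p q fin card W unfolding has_mean_def by simp
    finally show ?thesis .
  qed
  then have "(\<Sum>xs\<in>permutations_of_set V. pattern_weight w xs) =
      of_nat ((m + k) choose m) * (fact m * p * (fact k * q))"
    using V by (simp add: sum_permutations_of_set_split[OF V] n_subsets)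
  also have "of_nat ((m + k) choose m) = (fact (m + k) / (fact m * fact k) :: rat)"
    by (simp add: binomial_fact)
  finally show "(\<Sum>xs\<in>permutations_of_set V. pattern_weight w xs) = fact (m + k) * (p * q)"
    by simp
qed

text \<open>The mean is linear in the weight at a single gap.\<close>

lemma has_mean_diff:
  assumes u: "has_mean u n p" and v: "has_mean v n q" and m: "m \<in> {1..<n}"
    and wm: "\<And>b. w m b = u m b - v m b"
    and eq: "\<And>a. a \<in> {1..<n} \<Longrightarrow> a \<noteq> m \<Longrightarrow> u a = w a \<and> v a = w a"
  shows "has_mean w n (p - q)"
  unfolding has_mean_def
proof (intro allI impI, elim conjE)
  fix V :: "nat set" assume V: "finite V" "card V = n"
  have "pattern_weight w xs = pattern_weight u xs - pattern_weight v xs"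
    if "xs \<in> permutations_of_set V" for xs
  proof -
    let ?b = "\<lambda>a. xs ! (a - 1) < xs ! a"
    have *: "pattern_weight x xs = x m (?b m) * (\<Prod>a\<in>{1..<n}-{m}. x a (?b a))" for x
      using m V length_finite_permutations_of_set[OF that] unfolding pattern_weight_def
      by (subst prod.remove[of _ m]) auto
    have "(\<Prod>a\<in>{1..<n}-{m}. u a (?b a)) = (\<Prod>a\<in>{1..<n}-{m}. w a (?b a))"
      using eq by (intro prod.cong) auto
    moreover have "(\<Prod>a\<in>{1..<n}-{m}. v a (?b a)) = (\<Prod>a\<in>{1..<n}-{m}. w a (?b a))"
      using eq by (intro prod.cong) auto
    ultimately show ?thesis by (simp add: * wm left_diff_distrib)
  qed
  then show "(\<Sum>xs\<in>permutations_of_set V. pattern_weight w xs) = fact n * (p - q)"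
    using u v V unfolding has_mean_def by (simp add: sum_subtractf right_diff_distrib)
qed

text \<open>Only the increasing arrangement has a nonzero weight.\<close>

lemma has_mean_ascending:
  assumes "n \<ge> 1"
  shows "has_mean (\<lambda>_ b. 2 * of_bool b) n (2 ^ (n - 1) / fact n)"
  unfolding has_mean_def
proof (intro allI impI, elim conjE)
  fix V :: "nat set" assume V: "finite V" "card V = n"
  let ?s = "sorted_list_of_set V"
  have s: "?s \<in> permutations_of_set V" using V by (simp add: permutations_of_set_def)
  have weight: "pattern_weight (\<lambda>_ b. 2 * of_bool b) xs = (if xs = ?s then 2 ^ (n - 1) else 0)"
    if xs: "xs \<in> permutations_of_set V" for xs
  proof -
    have len: "length xs = n" using xs V by (simp add: length_finite_permutations_of_set)
    have "sorted_wrt (<) xs \<longleftrightarrow> xs = ?s"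
      using xs V by (metis permutations_of_setD(1) sorted_list_of_set.idem_if_sorted_distinct
          strict_sorted_iff strict_sorted_list_of_set subset_UNIV)
    moreover have "sorted_wrt (<) xs \<longleftrightarrow> (\<forall>a\<in>{1..<n}. xs ! (a - 1) < xs ! a)"
    proof
      assume "sorted_wrt (<) xs"
      then show "\<forall>a\<in>{1..<n}. xs ! (a - 1) < xs ! a"
        using len by (auto simp: sorted_wrt_iff_nth_less)
    next
      assume *: "\<forall>a\<in>{1..<n}. xs ! (a - 1) < xs ! a"
      then show "sorted_wrt (<) xs"
        using len by (auto simp: sorted_wrt_iff_nth_Suc_transp dest: bspec[of _ _ "Suc _"])
    qed
    moreover have "pattern_weight (\<lambda>_ b. 2 * of_bool b) xs = 2 ^ (n - 1)"
      if "\<forall>a\<in>{1..<n}. xs ! (a - 1) < xs ! a"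
      using that by (simp add: pattern_weight_def len)
    moreover have "pattern_weight (\<lambda>_ b. 2 * of_bool b) xs = 0"
      if "\<not> (\<forall>a\<in>{1..<n}. xs ! (a - 1) < xs ! a)"
      using that unfolding pattern_weight_def len by (intro prod_zero) auto
    ultimately show ?thesis by auto
  qed
  have "(\<Sum>xs\<in>permutations_of_set V. pattern_weight (\<lambda>_ b. 2 * of_bool b) xs) =
      (\<Sum>xs\<in>permutations_of_set V. if xs = ?s then 2 ^ (n - 1) else 0)"
    using weight by (intro sum.cong) auto
  also have "\<dots> = 2 ^ (n - 1)" using s by simp
  finally show "(\<Sum>xs\<in>permutations_of_set V. pattern_weight (\<lambda>_ b. 2 * of_bool b) xs) =
      fact n * (2 ^ (n - 1) / fact n)" by simp
qed

section \<open>The mean sign product over a full run\<close>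

text \<open>The sign of a gap as a function of whether it is an ascent.\<close>

definition sign_of :: "bool \<Rightarrow> rat" where
  "sign_of b = (if b then 1 else -1)"

text \<open>The coefficients of \<open>tanh\<close> through those of \<open>y = (exp (2z) - 1) / 2\<close>, by \<open>tanh * (1 + y) = y\<close>.\<close>

lemma fps_tanh_recurrence:
  assumes "n \<ge> 1"
  shows "fps_nth fps_tanh n = 2 ^ (n - 1) / fact n -
    (\<Sum>r\<in>{1..<n}. fps_nth fps_tanh r * (2 ^ (n - r - 1) / fact (n - r)))"
proof -
  define y :: "rat fps" where "y = fps_const (1/2) * (fps_exp 2 - 1)"
  have y: "fps_nth y 0 = 0" "fps_nth y k = 2 ^ (k - 1) / fact k" if "k \<ge> 1" for k
    using that by (auto simp: y_def power_eq_if)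
  define d :: "rat fps" where "d = fps_exp 1 + fps_exp (-1)"
  have d0: "fps_nth d 0 \<noteq> 0" by (simp add: d_def)
  then have d: "d \<noteq> 0" by (metis fps_zero_nth)
  have e: "fps_exp 1 * fps_exp 1 = (fps_exp 2 :: rat fps)" "fps_exp 1 * fps_exp (-1) = (1 :: rat fps)"
    by (simp_all flip: fps_exp_add_mult)
  have "fps_tanh * d = fps_exp 1 - fps_exp (-1)"
    unfolding fps_tanh_def d_def[symmetric] by (simp only: fps_divide_unit[OF d0] mult.assoc inverse_mult_eq_1[OF d0] mult_1_right)
  then have "fps_tanh * (fps_exp 1 * d) = fps_exp 1 * (fps_exp 1 - fps_exp (-1))"
    by (simp add: mult_ac)
  then have "fps_tanh * (fps_exp 2 + 1) = fps_exp 2 - 1"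
    unfolding d_def by (simp add: algebra_simps e)
  then have "fps_const (1/2) * (fps_tanh * (fps_exp 2 + 1)) = y"
    unfolding y_def by simp
  moreover have "fps_const (1/2) * (fps_exp 2 + 1) = 1 + y"
    unfolding y_def by (rule fps_ext) (simp add: algebra_simps)
  ultimately have rec: "fps_tanh * (1 + y) = y"
    by (metis mult.left_commute)
  have t0: "fps_nth fps_tanh 0 = 0"
    using arg_cong[OF rec, of "\<lambda>f. fps_nth f 0"] y(1)[of 1] by (simp add: fps_mult_nth)
  have "{0..n} = insert 0 (insert n {1..<n})" using assms by auto
  then have "fps_nth (fps_tanh * y) n = (\<Sum>r\<in>{1..<n}. fps_nth fps_tanh r * fps_nth y (n - r))"
    using assms t0 y(1)[of 1] by (simp add: fps_mult_nth)
  also have "\<dots> = (\<Sum>r\<in>{1..<n}. fps_nth fps_tanh r * (2 ^ (n - r - 1) / fact (n - r)))"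
    by (intro sum.cong) (auto simp: y(2))
  finally show ?thesis
    using arg_cong[OF rec, of "\<lambda>f. fps_nth f n"] y(2)[OF assms] by (simp add: ring_distribs)
qed

text \<open>A list of \<open>n\<close> entries has \<open>n - 1\<close> gaps, so this is the run of length \<open>n - 1\<close>, in accordance with
  \<open>T\<^bsub>n-1\<^esub>\<close> being the \<open>n\<close>-th coefficient of \<open>tanh\<close>.\<close>

lemma has_mean_signs:
  assumes "n \<ge> 1"
  shows "has_mean (\<lambda>_. sign_of) n (fps_nth fps_tanh n)"
  using assms
proof (induction n rule: less_induct)
  case (less n)
  \<comment> \<open>The weights \<open>w r\<close> interpolate between twice the ascent indicator everywhere (\<open>r = 1\<close>) and signs
    everywhere (\<open>r = n\<close>). Passing from \<open>r\<close> to \<open>r + 1\<close> subtracts 1 from the factor at the gap \<open>r\<close>.\<close>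
  define w where "w r a b = (if a < r then sign_of b else 2 * of_bool b)" for r a :: nat and b
  let ?h = "\<lambda>r. 2 ^ (n - 1) / fact n -
    (\<Sum>i\<in>{1..<r}. fps_nth fps_tanh i * (2 ^ (n - i - 1) / fact (n - i)))"
  have "has_mean (w r) n (?h r)" if "1 \<le> r" "r \<le> n" for r
    using that
  proof (induction r rule: dec_induct)
    case base
    have "has_mean (w 1) n (2 ^ (n - 1) / fact n) \<longleftrightarrow>
        has_mean (\<lambda>_ b. 2 * of_bool b) n (2 ^ (n - 1) / fact n)"
      by (rule has_mean_cong) (auto simp: w_def)
    then show ?case using has_mean_ascending[OF less.prems] by simp
  next
    case (step r)
    \<comment> \<open>The subtracted term: with factor 1 at the gap \<open>r\<close>, the arrangement splits there.\<close>
    define v where "v = (w r)(r := (\<lambda>_. 1))"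
    have "has_mean v (r + (n - r)) (fps_nth fps_tanh r * (2 ^ (n - r - 1) / fact (n - r)))"
    proof (rule has_mean_split)
      have "has_mean (\<lambda>_. sign_of) r (fps_nth fps_tanh r)"
        using less.IH step by simp
      then show "has_mean v r (fps_nth fps_tanh r)"
        by (subst has_mean_cong[where w' = "\<lambda>_. sign_of"]) (auto simp: v_def w_def)
      have "has_mean (\<lambda>_ b. 2 * of_bool b) (n - r) (2 ^ (n - r - 1) / fact (n - r))"
        using has_mean_ascending[of "n - r"] step by simp
      then show "has_mean (\<lambda>a. v (r + a)) (n - r) (2 ^ (n - r - 1) / fact (n - r))"
        by (subst has_mean_cong[where w' = "\<lambda>_ b. 2 * of_bool b"]) (auto simp: v_def w_def)
    qed (simp add: v_def)
    then have v: "has_mean v n (fps_nth fps_tanh r * (2 ^ (n - r - 1) / fact (n - r)))"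
      using step by simp
    have "has_mean (w (Suc r)) n (?h r - fps_nth fps_tanh r * (2 ^ (n - r - 1) / fact (n - r)))"
    proof (rule has_mean_diff[OF _ v, where m = r])
      show "has_mean (w r) n (?h r)" using step by simp
    qed (use step in \<open>auto simp: v_def w_def sign_of_def fun_eq_iff\<close>)
    moreover have "{1..<Suc r} = insert r {1..<r}" using step by auto
    ultimately show ?case by (simp add: algebra_simps)
  qed
  from this[of n] have "has_mean (w n) n (fps_nth fps_tanh n)"
    using less.prems fps_tanh_recurrence[of n] by simp
  then show ?case
    by (subst has_mean_cong[where w' = "w n"]) (auto simp: w_def)
qed


section \<open>The mean sign product over an arbitrary set\<close>

text \<open>The weight \<open>\<Prod>a\<in>A. \<sigma>\<^sub>a\<close>: gaps outside \<open>A\<close> have factor 1.\<close>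

definition signs_on :: "nat set \<Rightarrow> nat \<Rightarrow> bool \<Rightarrow> rat" where
  "signs_on A a b = (if a \<in> A then sign_of b else 1)"

lemma has_mean_one: "has_mean (\<lambda>_ _. 1) n 1"
  by (auto simp: has_mean_def pattern_weight_def)

text \<open>Induction on the cardinality of \<open>A\<close>, splitting off its last maximal run.\<close>

lemma has_mean_signs_on:
  assumes "A \<subseteq> {1..<n}"
  shows "has_mean (signs_on A) n (universal_series A)"
  using assms
proof (induction "card A" arbitrary: A n rule: less_induct)
  case (less A n)
  show ?case
  proof (cases "A = {}")
    case True
    then show ?thesis using has_mean_one by (simp add: signs_on_def[abs_def] universal_series_empty)
  next
    case False
    have fin: "finite A" using less.prems finite_subset by blast
    \<comment> \<open>The last maximal run of \<open>A\<close> is \<open>{m+1..b}\<close>. Since \<open>0 \<notin> A\<close>, there is a gap \<open>m < b\<close> outside \<open>A\<close>.\<close>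
    define b where "b = Max A"
    define m where "m = Max ({0..b} - A)"
    have b: "b \<in> A" "\<And>a. a \<in> A \<Longrightarrow> a \<le> b" using False fin by (auto simp: b_def)
    have ne: "{0..b} - A \<noteq> {}" using less.prems by force
    have m: "m \<le> b" "m \<notin> A" using Max_in[OF _ ne] by (auto simp: m_def)
    have m': "a \<in> A" if "m < a" "a \<le> b" for a
    proof (rule ccontr)
      assume "a \<notin> A"
      then have "a \<le> m" using that by (auto simp: m_def intro!: Max_ge)
      then show False using that by simp
    qed
    have mb: "m < b" using m b by (metis le_neq_implies_less)
    define B where "B = A \<inter> {..<m}"
    define k where "k = b - m"
    have A: "A = B \<union> {m+1..m+k}"
    proof (intro set_eqI)
      fix a
      show "a \<in> A \<longleftrightarrow> a \<in> B \<union> {m+1..m+k}"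
        using b(2)[of a] m m'[of a] mb by (cases a m rule: linorder_cases) (auto simp: B_def k_def)
    qed
    have B: "B \<subseteq> {..<m}" "B \<subseteq> {1..<m}" using less.prems by (auto simp: B_def)
    have k: "k \<ge> 1" using mb by (simp add: k_def)
    have bn: "b < n" using b less.prems by auto
    have "b \<notin> B" "B \<subseteq> A" using mb by (auto simp: B_def)
    then have "card B < card A" using b(1) fin by (metis psubsetI psubset_card_mono)
    then have IH: "has_mean (signs_on B) m (universal_series B)"
      using less.hyps B by blast
    \<comment> \<open>A run of \<open>k\<close> gaps occupies \<open>k + 1\<close> entries.\<close>
    have "has_mean (signs_on A) (m + (k + 1)) (universal_series B * tanh_coeff k)"
    proof (rule has_mean_split)
      show "has_mean (signs_on A) m (universal_series B)"
        using IH by (subst has_mean_cong[where w' = "signs_on B"])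
          (auto simp: A signs_on_def fun_eq_iff)
      have "has_mean (\<lambda>_. sign_of) (k + 1) (tanh_coeff k)"
        using has_mean_signs[of "k + 1"] by (simp add: tanh_coeff_def)
      then show "has_mean (\<lambda>a. signs_on A (m + a)) (k + 1) (tanh_coeff k)"
        using B(1) by (subst has_mean_cong[where w' = "\<lambda>_. sign_of"])
          (auto simp: A signs_on_def fun_eq_iff)
    qed (use m in \<open>auto simp: signs_on_def fun_eq_iff\<close>)
    then have "has_mean (signs_on A) (b + 1) (universal_series A)"
      using mb by (simp only: A universal_series_separated_union[OF B(1) k]) (simp add: k_def)
    \<comment> \<open>The entries after the last run carry no sign.\<close>
    then have "has_mean (signs_on A) (b + 1 + (n - (b + 1))) (universal_series A * 1)"
    proof (rule has_mean_split)
      have nA: "a \<notin> A" if "b < a" for a using b(2) that by force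
      then show "signs_on A (b + 1) = (\<lambda>_. 1)" by (auto simp: signs_on_def fun_eq_iff)
      show "has_mean (\<lambda>a. signs_on A (b + 1 + a)) (n - (b + 1)) 1"
        using nA by (subst has_mean_cong[where w' = "\<lambda>_ _. 1"])
          (auto simp: signs_on_def has_mean_one fun_eq_iff)
    qed
    then show ?thesis using bn by simp
  qed
qed


section \<open>From arrangements to signatures\<close>

lemma bij_betw_permutes_permutations_of_set:
  "bij_betw (\<lambda>\<pi>. map \<pi> [1..<n+1]) {\<pi>. \<pi> permutes {1..n}} (permutations_of_set {1..n})"
proof -
  let ?f = "\<lambda>\<pi> :: nat \<Rightarrow> nat. map \<pi> [1..<n+1]"
  have inj: "inj_on ?f {\<pi>. \<pi> permutes {1..n}}"
  proof (rule inj_onI)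
    fix \<pi> \<rho> assume *: "\<pi> \<in> {\<pi>. \<pi> permutes {1..n}}" "\<rho> \<in> {\<pi>. \<pi> permutes {1..n}}" "?f \<pi> = ?f \<rho>"
    show "\<pi> = \<rho>"
    proof
      fix i show "\<pi> i = \<rho> i"
        using * by (cases "i \<in> {1..n}") (auto simp: permutes_not_in simp del: upt_Suc)
    qed
  qed
  have sub: "?f ` {\<pi>. \<pi> permutes {1..n}} \<subseteq> permutations_of_set {1..n}"
  proof (rule image_subsetI)
    fix \<pi> assume "\<pi> \<in> {\<pi>. \<pi> permutes {1..n}}"
    then have \<pi>: "\<pi> permutes {1..n}" by simp
    have "set [1..<n+1] = {1..n}" by auto
    then show "?f \<pi> \<in> permutations_of_set {1..n}"
      using permutes_image[OF \<pi>] permutes_inj_on[OF \<pi>]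
      by (auto simp: permutations_of_set_def distinct_map)
  qed
  have "card (?f ` {\<pi>. \<pi> permutes {1..n}}) = card (permutations_of_set {1..n})"
    using card_permutations[of "{1..n}" n]
    by (simp only: card_image[OF inj] card_permutations_of_set finite_atLeastAtMost) simp
  then have "?f ` {\<pi>. \<pi> permutes {1..n}} = permutations_of_set {1..n}"
    using sub by (intro card_subset_eq) auto
  then show ?thesis using inj by (simp add: bij_betw_def)
qed

lemma sum_permutes_signature:
  assumes A: "A \<subseteq> {1..N}"
  shows "(\<Sum>\<pi> | \<pi> permutes {1..N+1}. \<Prod>a\<in>A. of_int (updown_signature N \<pi> a)) =
    fact (N + 1) * universal_series A"
proof -
  have "A \<subseteq> {1..<N+1}" using A by auto
  then have "fact (N + 1) * universal_series A =
      (\<Sum>xs\<in>permutations_of_set {1..N+1}. pattern_weight (signs_on A) xs)"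
    using has_mean_signs_on[of A "N + 1"] by (auto simp: has_mean_def)
  also have "\<dots> = (\<Sum>\<pi> | \<pi> permutes {1..N+1}. pattern_weight (signs_on A) (map \<pi> [1..<N+1+1]))"
    by (rule sum.reindex_bij_betw[OF bij_betw_permutes_permutations_of_set, symmetric])
  also have "\<dots> = (\<Sum>\<pi> | \<pi> permutes {1..N+1}. \<Prod>a\<in>A. of_int (updown_signature N \<pi> a))"
  proof (intro sum.cong refl)
    fix \<pi> assume "\<pi> \<in> {\<pi>. \<pi> permutes {1..N+1}}"
    then have inj: "inj \<pi>" by (auto intro: permutes_inj)
    have nth: "map \<pi> [1..<N+1+1] ! i = \<pi> (i + 1)" if "i \<le> N" for i
      using that by (simp del: upt_Suc)
    have "pattern_weight (signs_on A) (map \<pi> [1..<N+1+1]) =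
        (\<Prod>a\<in>{1..N}. signs_on A a (\<pi> a < \<pi> (a + 1)))"
      unfolding pattern_weight_def
      by (intro prod.cong) (auto simp: nth simp del: upt_Suc map_upt_Suc)
    also have "\<dots> = (\<Prod>a\<in>A. sign_of (\<pi> a < \<pi> (a + 1)))"
      unfolding signs_on_def using A by (simp add: prod.If_cases Int_absorb1 Int_absorb2)
    also have "\<dots> = (\<Prod>a\<in>A. of_int (updown_signature N \<pi> a))"
    proof (intro prod.cong refl)
      fix a assume "a \<in> A"
      moreover have "\<pi> a \<noteq> \<pi> (a + 1)" using injD[OF inj, of a "a + 1"] by auto
      ultimately show "sign_of (\<pi> a < \<pi> (a + 1)) = of_int (updown_signature N \<pi> a)"
        using A by (auto simp: updown_signature_def sign_of_def sgn_if)
    qed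
    finally show "pattern_weight (signs_on A) (map \<pi> [1..<N+1+1]) =
      (\<Prod>a\<in>A. of_int (updown_signature N \<pi> a))" .
  qed
  finally show ?thesis by simp
qed

lemma updown_signature_in_sign_vectors:
  assumes "\<pi> permutes {1..N+1}"
  shows "updown_signature N \<pi> \<in> sign_vectors N"
proof -
  \<comment> \<open>\<open>sgn\<close> never takes its value 0, because \<open>\<pi>\<close> is injective.\<close>
  have "\<pi> (i + 1) \<noteq> \<pi> i" for i
    using injD[OF permutes_inj[OF assms], of "i + 1" i] by auto
  then show ?thesis
    by (auto simp: updown_signature_def sign_vectors_def sgn_if)
qed

lemma prod_one_plus_signs:
  assumes "\<sigma> \<in> sign_vectors N" "\<tau> \<in> sign_vectors N"
  shows "(\<Prod>a\<in>{1..N}. 1 + of_int (\<tau> a) * of_int (\<sigma> a)) = (if \<tau> = \<sigma> then 2 ^ N else 0 :: rat)"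
proof -
  have val: "\<sigma> a = 1 \<or> \<sigma> a = -1" "\<tau> a = 1 \<or> \<tau> a = -1" if "a \<in> {1..N}" for a
    using PiE_mem[OF assms(1)[unfolded sign_vectors_def] that]
      PiE_mem[OF assms(2)[unfolded sign_vectors_def] that] by simp_all
  show ?thesis
  proof (cases "\<tau> = \<sigma>")
    case True
    have "(\<Prod>a\<in>{1..N}. 1 + of_int (\<tau> a) * of_int (\<sigma> a)) = (\<Prod>a\<in>{1..N}. 2 :: rat)"
      using val(1) True by (intro prod.cong refl) force
    then show ?thesis using True by simp
  next
    case False
    then obtain a where "a \<in> {1..N}" "\<tau> a \<noteq> \<sigma> a"
      using PiE_ext[OF assms(2,1)[unfolded sign_vectors_def]] by blast
    then have "\<exists>a\<in>{1..N}. 1 + of_int (\<tau> a) * of_int (\<sigma> a) = (0 :: rat)"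
      using val[of a] by (intro bexI[of _ a]) auto
    then show ?thesis using False by (simp add: prod_zero)
  qed
qed

text \<open>Both sides are the sum of \<open>\<Prod>a\<in>{1..N}. 1 + \<sigma>\<^sub>a(\<pi>) \<sigma>\<^sub>a\<close> over all \<open>\<pi>\<close>, where \<open>\<sigma>(\<pi>)\<close> is the signature
  of \<open>\<pi>\<close>.\<close>

lemma universal_sum_eq_updown_count:
  assumes \<sigma>: "\<sigma> \<in> sign_vectors N"
  shows "fact (N + 1) * (\<Sum>A\<in>Pow {1..N}. universal_series A * (\<Prod>a\<in>A. of_int (\<sigma> a))) =
    2 ^ N * of_nat (updown_count N \<sigma>)"
proof -
  let ?P = "{\<pi>. \<pi> permutes {1..N+1}}"
  have finP: "finite ?P" by (simp add: finite_permutations)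
  have "fact (N + 1) * (\<Sum>A\<in>Pow {1..N}. universal_series A * (\<Prod>a\<in>A. of_int (\<sigma> a))) =
      (\<Sum>A\<in>Pow {1..N}. (\<Sum>\<pi>\<in>?P. \<Prod>a\<in>A. of_int (updown_signature N \<pi> a)) * (\<Prod>a\<in>A. of_int (\<sigma> a)))"
    unfolding sum_distrib_left
    by (intro sum.cong refl) (simp only: sum_permutes_signature Pow_iff mult.assoc)
  also have "\<dots> = (\<Sum>\<pi>\<in>?P. \<Sum>A\<in>Pow {1..N}. \<Prod>a\<in>A. of_int (updown_signature N \<pi> a) * of_int (\<sigma> a))"
    by (subst sum.swap) (simp add: sum_distrib_right prod.distrib)
  also have "\<dots> = (\<Sum>\<pi>\<in>?P. \<Prod>a\<in>{1..N}. 1 + of_int (updown_signature N \<pi> a) * of_int (\<sigma> a))"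
    using prod_add[of "{1..N}" "\<lambda>a. of_int (updown_signature N \<pi> a) * of_int (\<sigma> a)" "\<lambda>_. 1 :: rat" for \<pi>]
    by (simp add: add.commute)
  also have "\<dots> = (\<Sum>\<pi>\<in>?P. if updown_signature N \<pi> = \<sigma> then 2 ^ N else 0)"
    using \<sigma> by (intro sum.cong refl)
      (simp only: mem_Collect_eq prod_one_plus_signs updown_signature_in_sign_vectors)
  also have "\<dots> = 2 ^ N * of_nat (updown_count N \<sigma>)"
    unfolding sum.If_cases[OF finP] updown_count_def Collect_conj_eq by simp
  finally show ?thesis .
qed

lemma mconst_mult: "mconst (r * s) = mconst r * mconst s"
  unfolding mconst_def mult_single by simp

lemma mconst_mult_multilinear_comb:
  "mconst r * multilinear_comb N c = multilinear_comb N (\<lambda>A. r * c A)"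
  by (simp only: multilinear_comb_def sum_distrib_left mconst_mult mult.assoc)

lemma multilinear_interpolant_eqI:
  assumes "\<And>\<sigma>. \<sigma> \<in> sign_vectors N \<Longrightarrow>
    (\<Sum>A\<in>Pow {1..N}. c A * (\<Prod>a\<in>A. of_int (\<sigma> a))) = f \<sigma>"
  shows "multilinear_interpolant N f = multilinear_comb N c"
proof -
  have "interpolates N f (multilinear_comb N c)"
    using assms by (auto simp: interpolates_def multilinear_def mpoly_eval_multilinear_comb)
  then show ?thesis
    using interpolates_ex1 interpolates_multilinear_interpolant by blast
qed

theorem theorem2p4:
  fixes N :: nat
  assumes "N \<ge> 1"
  shows "p_poly N = mconst (1 / 2 ^ N) * universal_poly N
       \<and> c_poly N = mconst (fact (N + 1) / 2 ^ N) * universal_poly N"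
proof
  have scale: "(\<Sum>A\<in>Pow {1..N}. r * universal_series A * (\<Prod>a\<in>A. of_int (\<sigma> a))) =
      r * (2 ^ N * of_nat (updown_count N \<sigma>) / fact (N + 1))" if "\<sigma> \<in> sign_vectors N" for r \<sigma>
  proof -
    have "(\<Sum>A\<in>Pow {1..N}. universal_series A * (\<Prod>a\<in>A. of_int (\<sigma> a))) =
        2 ^ N * of_nat (updown_count N \<sigma>) / fact (N + 1)"
      using universal_sum_eq_updown_count[OF that] by (metis fact_nonzero nonzero_mult_div_cancel_left)
    then show ?thesis by (simp only: mult.assoc flip: sum_distrib_left)
  qed
  show "p_poly N = mconst (1 / 2 ^ N) * universal_poly N"
    unfolding p_poly_def universal_poly_def mconst_mult_multilinear_comb
    by (rule multilinear_interpolant_eqI) (simp only: scale, simp add: updown_prob_def)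
  show "c_poly N = mconst (fact (N + 1) / 2 ^ N) * universal_poly N"
    unfolding c_poly_def universal_poly_def mconst_mult_multilinear_comb
    by (rule multilinear_interpolant_eqI) (simp only: scale, simp del: fact_Suc)
qed

end
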